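(* Let $n\in\mathbb{N}$ and $s\in\mathbb{C}\setminus\{-1,-2,-3,\dots\}$. Then \begin{align*} &\sum_{k=1}^{n}\binom{s+n}{k}\frac{(-1)^{k-1}}{k^2}\Big\{(\psi(s+n+1)-\psi(s+n-k+1))^2+\psi'(s+n+1)-\psi'(s+n-k+1)\Big\}\\ &=2\sum_{k=0}^{n-1}\frac{(-1)^k}{k+1}\binom{s+k}{k}\frac{H_n-H_k}{(n-k)\binom{n}{k}}[\psi(s+k+1)-\psi(s+1)]\\ &\quad+s\sum_{k=0}^{n-1}\frac{(-1)^k}{k+1}\binom{s+k}{k}\frac{H_n-H_k}{(n-k)\binom{n}{k}}\Big\{(\psi(s+k+1)-\psi(s+1))^2+\psi'(s+k+1)-\psi'(s+1)\Big\}. \end{align*}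
   Context: $\psi=\Gamma'/\Gamma$ is the digamma function and $\psi'$ its derivative. $H_m=\sum_{j=1}^m\frac1j$, $H_0=0$. For $z\in\mathbb{C}$ and $k\in\mathbb{N}_0$, $\binom{z}{k}=\frac{z(z-1)\cdots(z-k+1)}{k!}$. *)

theory Defs
  imports "HOL-Analysis.Analysis"
begin

text \<open>
  The digamma function \<open>\<psi> = \<Gamma>'/\<Gamma>\<close> is the library's \<^const>\<open>Digamma\<close>; all arguments at
  which it is used lie outside its poles.  The numbers \<open>H\<^sub>m\<close> are \<^const>\<open>harm\<close>, and the binomial
  coefficient with complex upper argument is \<^const>\<open>gbinomial\<close>.
\<close>

end

theory Submission
  imports Defs "HOL-Computational_Algebra.Polynomial"
begin

text \<open>
  Since the derivative of \<open>binom(z, k)\<close> in \<open>z\<close> is \<open>binom(z, k) (\<psi>(z + 1) - \<psi>(z - k + 1))\<close>, the theorem is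
  the second derivative of the polynomial identity
  \[ \sum_{k=1}^n \binom{s+n}{k} \frac{(-1)^{k-1}}{k^2}
     = \sum_{k=1}^n \binom{n}{k} \frac{(-1)^{k-1}}{k^2}
     + s \sum_{k=0}^{n-1} \frac{(-1)^k}{k+1} \binom{s+k}{k} \frac{H_n-H_k}{(n-k)\binom{n}{k}}. \]
  Both sides have degree at most \<open>n\<close>, so it is enough to compare them at \<open>s = 0, -1, \<dots>, -n\<close>. They agree
  at \<open>0\<close>, and from \<open>-m - 1\<close> to \<open>-m\<close> both increase by \<open>H\<^bsub>n-m\<^esub> / (n - m)\<close>.
\<close>

section \<open>Sums of binomial coefficients and harmonic numbers\<close>

text \<open>Induction with Pascal's rule. The increment from \<open>n\<close> to
  \<open>Suc n\<close> is the sum of binom(n, k-1) (-1)^(k-1) / k. Absorption turns this into the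
  alternating sum of row \<open>Suc n\<close> without its first entry, divided by
  \<open>Suc n\<close>, that is 1/(n+1).\<close>

lemma sum_choose_alternating_over_index:
  "(\<Sum>k = 1..n. of_nat (n choose k) * ((-1) ^ (k - 1) / of_nat k)) = (harm n :: 'a :: real_normed_field)"
proof (induction n)
  case (Suc n)
  have "(\<Sum>k = 1..Suc n. of_nat (Suc n choose k) * ((-1) ^ (k - 1) / of_nat k))
      = (\<Sum>k = 1..Suc n. of_nat (n choose k) * ((-1) ^ (k - 1) / of_nat k) +
          of_nat (n choose (k - 1)) * ((-1) ^ (k - 1) / of_nat k) :: 'a)"
    by (intro sum.cong refl) (auto simp: choose_reduce_nat algebra_simps add_divide_distrib)
  also have "\<dots> = harm n + (\<Sum>k = 1..Suc n. of_nat (n choose (k - 1)) * ((-1) ^ (k - 1) / of_nat k))"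
    using Suc by (simp add: sum.distrib)
  also have "(\<Sum>k = 1..Suc n. of_nat (n choose (k - 1)) * ((-1) ^ (k - 1) / of_nat k) :: 'a)
      = (\<Sum>k\<le>n. of_nat (n choose k) * ((-1) ^ k / of_nat (Suc k)))"
    unfolding One_nat_def sum.shift_bounds_cl_Suc_ivl by (simp add: atLeast0AtMost)
  also have "\<dots> = (\<Sum>k\<le>n. (-1) ^ k * of_nat (Suc n choose Suc k)) / of_nat (Suc n)"
    unfolding sum_divide_distrib
  proof (intro sum.cong refl)
    fix k
    have "of_nat (Suc k * (Suc n choose Suc k)) = (of_nat (Suc n * (n choose k)) :: 'a)"
      by (simp only: Suc_times_binomial_eq mult_ac)
    then show "of_nat (n choose k) * ((-1) ^ k / of_nat (Suc k)) =
        ((-1) ^ k * of_nat (Suc n choose Suc k) / of_nat (Suc n) :: 'a)"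
      unfolding of_nat_mult by (simp add: field_simps del: of_nat_Suc binomial_Suc_Suc)
  qed
  also have "(\<Sum>k\<le>n. (-1) ^ k * of_nat (Suc n choose Suc k)) = (1 :: 'a)"
    using choose_alternating_sum[of "Suc n", where 'a = 'a]
    by (simp add: sum.atMost_Suc_shift sum_negf del: binomial_Suc_Suc sum.atMost_Suc)
  finally show ?case by (simp add: harm_Suc divide_inverse)
qed (simp add: harm_def)

text \<open>After Pascal's rule, absorption replaces binom(n, k-1) / k^2 by binom(n+1, k) / ((n+1)
  k). One power of \<open>k\<close> is lost, and the previous lemma at \<open>Suc n\<close>
  evaluates the remainder. This is the increment of the left side between neighbouring negative
  integers.\<close>

lemma sum_choose_alternating_over_index_sq_Suc:
  "(\<Sum>k = 1..Suc n. of_nat (Suc n choose k) * ((-1) ^ (k - 1) / of_nat k ^ 2)) =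
   (\<Sum>k = 1..n. of_nat (n choose k) * ((-1) ^ (k - 1) / of_nat k ^ 2)) +
   (harm (Suc n) / of_nat (Suc n) :: 'a :: real_normed_field)"
proof -
  have "(\<Sum>k = 1..Suc n. of_nat (Suc n choose k) * ((-1) ^ (k - 1) / of_nat k ^ 2))
      = (\<Sum>k = 1..Suc n. of_nat (n choose k) * ((-1) ^ (k - 1) / of_nat k ^ 2) +
          of_nat (Suc n choose k) * ((-1) ^ (k - 1) / of_nat k) / of_nat (Suc n) :: 'a)"
  proof (intro sum.cong refl)
    fix k assume "k \<in> {1..Suc n}"
    then obtain j where k: "k = Suc j" by (cases k) auto
    have "of_nat (Suc j * (Suc n choose Suc j)) = (of_nat (Suc n * (n choose j)) :: 'a)"
      by (simp only: Suc_times_binomial_eq mult_ac)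
    then have *: "of_nat (n choose j) = (of_nat (Suc j) * of_nat (Suc n choose Suc j) / of_nat (Suc n) :: 'a)"
      unfolding of_nat_mult by (simp add: field_simps del: of_nat_Suc binomial_Suc_Suc)
    have "of_nat (Suc n choose k) = (of_nat (n choose k) + of_nat (n choose j) :: 'a)"
      by (simp add: k)
    also note *
    finally have "of_nat (Suc n choose k) * ((-1) ^ (k - 1) / of_nat k ^ 2) =
      (of_nat (n choose k) + of_nat k * of_nat (Suc n choose k) / of_nat (Suc n) :: 'a) * ((-1) ^ (k - 1) / of_nat k ^ 2)"
      unfolding k by simp
    moreover have "of_nat k \<noteq> (0 :: 'a)" using k by (simp del: of_nat_Suc)
    ultimately show "of_nat (Suc n choose k) * ((-1) ^ (k - 1) / of_nat k ^ 2) =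
          of_nat (n choose k) * ((-1) ^ (k - 1) / of_nat k ^ 2) +
          of_nat (Suc n choose k) * ((-1) ^ (k - 1) / of_nat k) / (of_nat (Suc n) :: 'a)"
      by (simp add: field_simps power2_eq_square del: of_nat_Suc binomial_Suc_Suc)
  qed
  also have "\<dots> = (\<Sum>k = 1..n. of_nat (n choose k) * ((-1) ^ (k - 1) / of_nat k ^ 2)) +
      (\<Sum>k = 1..Suc n. of_nat (Suc n choose k) * ((-1) ^ (k - 1) / of_nat k)) / of_nat (Suc n)"
    by (simp add: sum.distrib sum_divide_distrib add_divide_distrib)
  finally show ?thesis by (simp only: sum_choose_alternating_over_index)
qed

lemma sum_harm: "(\<Sum>k\<le>m. harm k) = of_nat (m + 1) * (harm (m + 1) - 1 :: 'a :: real_normed_field)"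
proof (induction m)
  case (Suc m)
  have "(\<Sum>k\<le>Suc m. harm k) = of_nat (m + 2) * harm (m + 1) - (of_nat (m + 1) :: 'a)"
    using Suc by (simp add: algebra_simps)
  also have "of_nat (m + 2) * harm (m + 1) = of_nat (m + 2) * harm (m + 2) - (1 :: 'a)"
  proof -
    have "harm (m + 2) = harm (m + 1) + inverse (of_nat (m + 2) :: 'a)"
      using harm_Suc[of "m + 1", where 'a = 'a] by (simp add: eval_nat_numeral)
    moreover have "of_nat (m + 2) \<noteq> (0 :: 'a)" by (simp del: of_nat_add of_nat_Suc add: of_nat_eq_0_iff)
    ultimately show ?thesis by (simp add: distrib_left del: of_nat_add)
  qed
  finally show ?case by (simp add: algebra_simps)
qed (simp add: harm_def)

text \<open>The left side is the (t+1)-fold iterated partial sum of the harmonic numbers, so this is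
  the closed form of the hyperharmonic numbers. By Pascal's rule on the weights, the value at (t+1,
  m+1) is the sum of those at (t+1, m) and (t, m+1), hence the nested inductions.\<close>

lemma sum_choose_mult_harm:
  "(\<Sum>k\<le>m. of_nat ((t + (m - k)) choose (m - k)) * harm k) =
   of_nat ((m + t + 1) choose m) * (harm (m + t + 1) - harm (t + 1) :: 'a :: real_normed_field)"
proof (induction t arbitrary: m)
  case 0
  show ?case using sum_harm[of m, where 'a = 'a] by (simp add: harm_expand(1) harm_Suc)
next
  case (Suc t)
  note IH = Suc.IH
  show ?case
  proof (induction m)
    case 0
    show ?case by (simp add: harm_def)
  next
    case (Suc m)
    have "(\<Sum>k\<le>Suc m. of_nat ((Suc t + (Suc m - k)) choose (Suc m - k)) * harm k) =
        (\<Sum>k\<le>m. of_nat ((Suc t + (m - k)) choose (m - k)) * harm k +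
          of_nat ((t + (Suc m - k)) choose (Suc m - k)) * harm k) + (harm (Suc m) :: 'a)"
      by (simp add: Suc_diff_le algebra_simps)
    also have "\<dots> = (\<Sum>k\<le>m. of_nat ((Suc t + (m - k)) choose (m - k)) * harm k) +
        (\<Sum>k\<le>Suc m. of_nat ((t + (Suc m - k)) choose (Suc m - k)) * harm k)"
      by (simp add: sum.distrib)
    also have "\<dots> = of_nat ((m + t + 2) choose m) * (harm (m + t + 2) - harm (t + 2)) +
        of_nat ((m + t + 2) choose Suc m) * (harm (m + t + 2) - harm (t + 1))"
      unfolding Suc.IH IH by simp
    \<comment> \<open>Moving to the harmonic numbers of the goal leaves binom(m+t+2, m+1) / (t+2) on
      one side and binom(m+t+3, m+1) / (m+t+3) on the other. These agree by absorption.\<close>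
    also have "\<dots> = of_nat ((m + t + 3) choose Suc m) * (harm (m + t + 3) - harm (t + 2))"
    proof -
      have pascal: "(m + t + 3) choose Suc m = ((m + t + 2) choose m) + ((m + t + 2) choose Suc m)"
        by (simp add: eval_nat_numeral)
      have "of_nat (t + 2) * of_nat ((m + t + 3) choose Suc m) = (of_nat (m + t + 3) * of_nat ((m + t + 2) choose Suc m) :: 'a)"
      proof -
        have "m + t + 3 - Suc m = t + 2" "m + t + 3 - 1 = m + t + 2" by simp_all
        then show ?thesis
          using arg_cong[OF binomial_absorb_comp[of "m + t + 3" "Suc m"], of "of_nat :: nat \<Rightarrow> 'a"]
          by (simp only: of_nat_mult)
      qed
      moreover have "of_nat (t + 2) \<noteq> (0 :: 'a)" "of_nat (m + t + 3) \<noteq> (0 :: 'a)"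
        by (simp_all del: of_nat_add of_nat_Suc add: of_nat_eq_0_iff)
      ultimately have "of_nat ((m + t + 3) choose Suc m) / of_nat (m + t + 3) = (of_nat ((m + t + 2) choose Suc m) / of_nat (t + 2) :: 'a)"
        by (simp add: field_simps del: of_nat_add)
      moreover have "harm (m + t + 3) = harm (m + t + 2) + 1 / (of_nat (m + t + 3) :: 'a)"
        "harm (t + 2) = harm (t + 1) + 1 / (of_nat (t + 2) :: 'a)"
        using harm_Suc[of "m + t + 2", where 'a = 'a] harm_Suc[of "t + 1", where 'a = 'a]
        by (simp_all add: divide_inverse eval_nat_numeral)
      ultimately show ?thesis
        unfolding pascal of_nat_add[of "(m + t + 2) choose m"] by (simp add: algebra_simps add_divide_distrib)
    qed
    finally show ?case by (simp add: eval_nat_numeral)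
  qed
qed

text \<open>By the hockey-stick identity the weights add up to binom(m+t+1, m), so the terms with
  \<open>harm (m + t + 1)\<close> cancel against the previous lemma.\<close>

lemma sum_choose_mult_harm_diff:
  "(\<Sum>k\<le>m. of_nat ((t + (m - k)) choose (m - k)) * (harm (m + t + 1) - harm k)) =
   of_nat ((m + t + 1) choose m) * (harm (t + 1) :: 'a :: real_normed_field)"
proof -
  have "(\<Sum>k\<le>m. (t + (m - k)) choose (m - k)) = (\<Sum>k\<le>m. (t + k) choose k)"
    by (rule sum.reindex_bij_witness[of _ "\<lambda>k. m - k" "\<lambda>k. m - k"]) auto
  also have "\<dots> = (m + t + 1) choose m"
    using sum_choose_lower[of t m] by (simp add: add.commute)
  finally have "(\<Sum>k\<le>m. of_nat ((t + (m - k)) choose (m - k))) = (of_nat ((m + t + 1) choose m) :: 'a)"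
    by (metis of_nat_sum)
  then show ?thesis
    using sum_choose_mult_harm[of t m, where 'a = 'a]
    by (simp add: right_diff_distrib sum_subtractf sum_distrib_right[symmetric])
qed

text \<open>This will be the increment of the right side. With t = n-m-1, trinomial revision and
  absorption rewrite binom(m, k) / ((n-k) binom(n, k)) as binom(t+m-k, m-k) / ((t+1) binom(n, m)).
  The denominator no longer depends on \<open>k\<close>, so the previous lemma applies.\<close>

lemma sum_choose_mult_harm_weight:
  fixes m n :: nat
  assumes "m < n"
  shows "(\<Sum>k = 0..n - 1. of_nat (m choose k) *
            ((harm n - harm k) / ((of_nat n - of_nat k) * of_nat (n choose k)))) =
         (harm (n - m) / of_nat (n - m) :: 'a :: real_normed_field)"
proof -
  obtain t where n: "n = m + t + 1" using assms less_imp_Suc_add by auto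
  have "(\<Sum>k = 0..n - 1. of_nat (m choose k) *
            ((harm n - harm k) / ((of_nat n - of_nat k) * of_nat (n choose k)))) =
        (\<Sum>k\<le>m. of_nat (m choose k) *
            ((harm n - harm k) / ((of_nat n - of_nat k) * of_nat (n choose k))) :: 'a)"
    using assms by (intro sum.mono_neutral_right) (auto simp: binomial_eq_0)
  also have "\<dots> = (\<Sum>k\<le>m. of_nat ((t + (m - k)) choose (m - k)) * (harm n - harm k)) /
      (of_nat (n choose m) * of_nat (t + 1))"
    unfolding sum_divide_distrib
  proof (intro sum.cong refl)
    fix k assume "k \<in> {..m}"
    then have k: "k \<le> m" by simp
    have diff: "of_nat n - of_nat k = (of_nat (n - k) :: 'a)" using k n by (simp add: of_nat_diff)
    have "(n choose m) * (m choose k) * (t + 1) = (n choose k) * (((n - k) choose (m - k)) * (t + 1))"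
    proof -
      have "(n choose m) * (m choose k) = (n choose k) * ((n - k) choose (m - k))"
        using choose_mult[of k m n] k n by simp
      then show ?thesis by (simp only: mult.assoc)
    qed
    also have "((n - k) choose (m - k)) * (t + 1) = (n - k) * ((t + (m - k)) choose (m - k))"
    proof -
      have "n - k - (m - k) = t + 1" "n - k - 1 = t + (m - k)" using k n by auto
      then show ?thesis using binomial_absorb_comp[of "n - k" "m - k"] by (simp add: mult.commute)
    qed
    finally have "of_nat (n choose m) * of_nat (m choose k) * of_nat (t + 1) =
        (of_nat (n choose k) * (of_nat (n - k) * of_nat ((t + (m - k)) choose (m - k))) :: 'a)"
      by (metis of_nat_mult)
    moreover have "of_nat (n choose m) \<noteq> (0 :: 'a)" "of_nat (n choose k) \<noteq> (0 :: 'a)"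
        "of_nat (t + 1) \<noteq> (0 :: 'a)" "of_nat (n - k) \<noteq> (0 :: 'a)"
      using k n by (simp_all del: of_nat_add of_nat_Suc add: of_nat_eq_0_iff)
    ultimately have "of_nat (m choose k) / (of_nat (n - k) * of_nat (n choose k)) =
        (of_nat ((t + (m - k)) choose (m - k)) / (of_nat (n choose m) * of_nat (t + 1)) :: 'a)"
      by (simp add: divide_simps mult_ac del: of_nat_add)
    then have "of_nat (m choose k) / (of_nat (n - k) * of_nat (n choose k)) * (harm n - harm k) =
        (of_nat ((t + (m - k)) choose (m - k)) / (of_nat (n choose m) * of_nat (t + 1)) * (harm n - harm k) :: 'a)"
      by (rule arg_cong)
    then show "of_nat (m choose k) * ((harm n - harm k) / ((of_nat n - of_nat k) * of_nat (n choose k))) =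
        (of_nat ((t + (m - k)) choose (m - k)) * (harm n - harm k) / (of_nat (n choose m) * of_nat (t + 1)) :: 'a)"
      unfolding diff by simp
  qed
  also have "\<dots> = harm (n - m) / of_nat (n - m)"
    unfolding n sum_choose_mult_harm_diff
    by (simp add: field_simps del: of_nat_add of_nat_Suc)
  finally show ?thesis .
qed

section \<open>The underlying polynomial identity\<close>

lemma gchoose_shift_eq_poly:
  fixes c :: "'a :: field_char_0"
  shows "\<exists>p. degree p \<le> k \<and> (\<forall>x. poly p x = (x + c) gchoose k)"
proof (intro exI conjI allI)
  let ?p = "smult (inverse (fact k)) (\<Prod>i = 0..<k. [:c - of_nat i, 1:])"
  show "degree ?p \<le> k"
    using degree_prod_sum_le[of "{0..<k}" "\<lambda>i. [:c - of_nat i, 1:]"] by simp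
  show "poly ?p x = (x + c) gchoose k" for x
    by (simp add: poly_prod gbinomial_prod_rev divide_inverse algebra_simps)
qed

text \<open>Shift, lower index and weight may all vary with \<open>k\<close>, so that one degree
  bound serves both sides: the left has shift \<open>n\<close> and lower index \<open>k\<close>, the
  right has shift \<open>k\<close> and lower index \<open>k + 1\<close>.\<close>

lemma sum_gchoose_eq_poly:
  fixes c a :: "nat \<Rightarrow> 'a :: field_char_0" and d :: "nat \<Rightarrow> nat"
  assumes "finite A" "\<And>k. k \<in> A \<Longrightarrow> d k \<le> n"
  shows "\<exists>p. degree p \<le> n \<and> (\<forall>x. poly p x = (\<Sum>k\<in>A. ((x + c k) gchoose d k) * a k))"
proof -
  have "\<exists>p. \<forall>k. degree (p k) \<le> d k \<and> (\<forall>x. poly (p k) x = (x + c k) gchoose d k)"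
    using gchoose_shift_eq_poly by (intro choice allI) blast
  then obtain p where p: "\<And>k. degree (p k) \<le> d k" "\<And>k x. poly (p k) x = (x + c k) gchoose d k"
    by blast
  have "degree (\<Sum>k\<in>A. smult (a k) (p k)) \<le> n"
    using assms p(1) by (intro degree_sum_le) (auto intro: order.trans[OF degree_smult_le] order.trans)
  moreover have "poly (\<Sum>k\<in>A. smult (a k) (p k)) x = (\<Sum>k\<in>A. ((x + c k) gchoose d k) * a k)" for x
    by (simp add: poly_sum p(2) mult.commute)
  ultimately show ?thesis by blast
qed

lemma sum_gchoose_over_index_sq:
  fixes s :: complex
  shows "(\<Sum>k = 1..n. ((s + of_nat n) gchoose k) * ((-1) ^ (k - 1) / of_nat k ^ 2)) =
    (\<Sum>k = 1..n. of_nat (n choose k) * ((-1) ^ (k - 1) / of_nat k ^ 2)) +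
    s * (\<Sum>k = 0..n - 1. ((-1) ^ k / (of_nat k + 1)) * ((s + of_nat k) gchoose k) *
            ((harm n - harm k) / ((of_nat n - of_nat k) * of_nat (n choose k))))"
\<comment> \<open>For \<open>n = 0\<close> the range \<open>0..n - 1\<close> still contains
  \<open>k = 0\<close>, but that term has numerator \<open>harm 0 - harm 0\<close>. The degree bound
  k+1 \<le> n used below would fail there.\<close>
proof (cases "n = 0")
  case False
  define w :: "nat \<Rightarrow> complex"
    where "w k = (harm n - harm k) / ((of_nat n - of_nat k) * of_nat (n choose k))" for k
  define T :: complex where "T = (\<Sum>k = 1..n. of_nat (n choose k) * ((-1) ^ (k - 1) / of_nat k ^ 2))"
  define L where "L s = (\<Sum>k = 1..n. ((s + of_nat n) gchoose k) * ((-1) ^ (k - 1) / of_nat k ^ 2))" for s :: complex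
  define R where "R s = (\<Sum>k = 0..n - 1. ((s + of_nat k) gchoose (k + 1)) * ((-1) ^ k * w k))" for s :: complex
  \<comment> \<open>Absorbing the factor \<open>s\<close> by s binom(s+k, k) / (k+1) = binom(s+k,
    k+1) makes the right side a plain sum of binomials, to which Pascal's rule and the degree bound
    apply.\<close>
  have R_eq: "s * (\<Sum>k = 0..n - 1. ((-1) ^ k / (of_nat k + 1)) * ((s + of_nat k) gchoose k) * w k) = R s" for s
    unfolding R_def sum_distrib_left
  proof (intro sum.cong refl)
    fix k
    have "(of_nat k + 1) * ((s + of_nat k) gchoose (k + 1)) = s * ((s + of_nat k) gchoose k)"
      using gbinomial_absorb_comp[of "s + of_nat k" k] gbinomial_absorption[of k "s + of_nat k"]
      by (simp add: add.commute)
    moreover have "of_nat k + 1 \<noteq> (0 :: complex)"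
      by (metis of_nat_Suc of_nat_neq_0 add.commute)
    ultimately have "(s + of_nat k) gchoose (k + 1) = s * ((s + of_nat k) gchoose k) / (of_nat k + 1)"
      by (simp add: field_simps)
    then show "s * ((-1) ^ k / (of_nat k + 1) * ((s + of_nat k) gchoose k) * w k) =
        ((s + of_nat k) gchoose (k + 1)) * ((-1) ^ k * w k)"
      by simp
  qed
  have agree: "L (- of_nat m) = R (- of_nat m) + T" if "m \<le> n" for m
    using that
  proof (induction m)
    case 0
    have "(of_nat k gchoose Suc k) = (0 :: complex)" for k
      by (simp add: binomial_gbinomial[symmetric])
    then show ?case
      by (simp add: L_def R_def T_def binomial_gbinomial)
  next
    case (Suc m)
    then obtain r where r: "n = Suc (m + r)" using less_imp_Suc_add[of m n] by auto
    \<comment> \<open>At \<open>- of_nat j\<close> the upper argument is the natural number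
      \<open>n - j\<close>, so the sum stops there.\<close>
    have L_eq: "L (- of_nat j) = (\<Sum>k = 1..n - j. of_nat ((n - j) choose k) * ((-1) ^ (k - 1) / of_nat k ^ 2))"
      if "j \<le> n" for j
    proof -
      have "- of_nat j + of_nat n = (of_nat (n - j) :: complex)" using that by (simp add: of_nat_diff)
      then have "L (- of_nat j) = (\<Sum>k = 1..n. of_nat ((n - j) choose k) * ((-1) ^ (k - 1) / of_nat k ^ 2))"
        unfolding L_def by (simp add: binomial_gbinomial)
      also have "\<dots> = (\<Sum>k = 1..n - j. of_nat ((n - j) choose k) * ((-1) ^ (k - 1) / of_nat k ^ 2))"
        using that by (intro sum.mono_neutral_right) (auto simp: binomial_eq_0)
      finally show ?thesis .
    qed
    have L_diff: "L (- of_nat m) = L (- of_nat (Suc m)) + harm (n - m) / of_nat (n - m)"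
      using L_eq[of m] L_eq[of "Suc m"] sum_choose_alternating_over_index_sq_Suc[of r, where 'a = complex] r
      by (simp add: Suc_diff_le)
    \<comment> \<open>Pascal's rule leaves binom(k-m-1, k), which upper negation turns into (-1)^k
      binom(m, k). Its sign cancels the one in \<open>R\<close>.\<close>
    have "R (- of_nat m) - R (- of_nat (Suc m)) = (\<Sum>k = 0..n - 1. of_nat (m choose k) * w k)"
      unfolding R_def sum_subtractf[symmetric]
    proof (intro sum.cong refl)
      fix k
      let ?z = "- of_nat (Suc m) + of_nat k :: complex"
      have "((- of_nat m + of_nat k) gchoose (k + 1)) = (?z gchoose k) + (?z gchoose (k + 1))"
        using gbinomial_Suc_Suc[of ?z k] by simp
      moreover have "?z gchoose k = (-1) ^ k * of_nat (m choose k)"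
        using gbinomial_negated_upper[of ?z k] by (simp add: binomial_gbinomial)
      ultimately show "((- of_nat m + of_nat k) gchoose (k + 1)) * ((-1) ^ k * w k) -
          (?z gchoose (k + 1)) * ((-1) ^ k * w k) = of_nat (m choose k) * w k"
        by (simp add: algebra_simps flip: power_add mult_2)
    qed
    also have "\<dots> = harm (n - m) / of_nat (n - m)"
      unfolding w_def using Suc.prems by (intro sum_choose_mult_harm_weight) simp
    finally have "R (- of_nat m) = R (- of_nat (Suc m)) + harm (n - m) / of_nat (n - m)"
      by (simp add: algebra_simps)
    then show ?case using L_diff Suc by simp
  qed
  have "\<exists>p. degree p \<le> n \<and> (\<forall>x. poly p x = L x)"
    unfolding L_def by (rule sum_gchoose_eq_poly) auto
  then obtain p where p: "degree p \<le> n" "\<And>x. poly p x = L x" by blast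
  have "\<exists>q. degree q \<le> n \<and> (\<forall>x. poly q x = R x)"
    unfolding R_def by (rule sum_gchoose_eq_poly) (use False in auto)
  then obtain q where q: "degree q \<le> n" "\<And>x. poly q x = R x" by blast
  have "p = q + [:T:]"
  proof (rule poly_eqI_degree)
    let ?A = "(\<lambda>m. - of_nat m :: complex) ` {..n}"
    show "poly p x = poly (q + [:T:]) x" if "x \<in> ?A" for x
      using that agree by (auto simp: p q)
    have "card ?A = Suc n" by (subst card_image) (auto simp: inj_on_def)
    then show "card ?A > degree p" "card ?A > degree (q + [:T:])"
      using p(1) degree_add_le[OF q(1), of "[:T:]"] by simp_all
  qed
  then have "L s = R s + T" using p(2)[of s] q(2)[of s] by simp
  then show ?thesis
    unfolding R_eq[unfolded w_def] L_def T_def by (simp add: add.commute)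
qed auto

section \<open>Derivatives of binomial coefficients\<close>

text \<open>Induction on \<open>k\<close> through binom(z, k+1) = binom(z, k) (z-k) / (k+1). With u
  = z-k, the recurrence \<psi>(u+1) = \<psi>(u) + 1/u produces a term -1/u, which after
  multiplication by \<open>u\<close> cancels the derivative of the linear factor.\<close>

lemma has_field_derivative_gchoose:
  fixes z :: complex
  assumes "z - of_nat k + 1 \<notin> \<int>\<^sub>\<le>\<^sub>0"
  shows "((\<lambda>z. z gchoose k) has_field_derivative
           (z gchoose k) * (Digamma (z + 1) - Digamma (z - of_nat k + 1))) (at z)"
  using assms
proof (induction k)
  case (Suc k)
  have nz: "z - of_nat k \<noteq> 0" using Suc.prems by auto
  have "z - of_nat k + 1 \<notin> \<int>\<^sub>\<le>\<^sub>0"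
    using plus_one_in_nonpos_Ints_imp[of "z - of_nat k"] Suc.prems by auto
  note IH = Suc.IH[OF this]
  have rec: "(x gchoose Suc k) = (x gchoose k) * (x - of_nat k) / of_nat (Suc k)" for x :: complex
    using gbinomial_mult_1[of x k] by (simp add: field_simps del: of_nat_Suc)
  define u v where "u = z - of_nat k" and "v = Digamma (z + 1) - Digamma u"
  have u: "u \<noteq> 0" "z - of_nat (Suc k) + 1 = u" using nz by (simp_all add: u_def)
  have v: "Digamma (z + 1) - Digamma (u + 1) = v - 1 / u"
    using Digamma_plus1[OF u(1)] by (simp add: v_def)
  have "((\<lambda>x. (x gchoose k) * (x - of_nat k) / of_nat (Suc k)) has_field_derivative
      ((z gchoose k) * (v - 1 / u) * u + (z gchoose k)) / of_nat (Suc k)) (at z)"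
  proof (rule DERIV_cdivide)
    have "((\<lambda>x. x - of_nat k) has_field_derivative 1) (at z)"
      by (auto intro!: derivative_eq_intros)
    then show "((\<lambda>x. (x gchoose k) * (x - of_nat k)) has_field_derivative
        (z gchoose k) * (v - 1 / u) * u + (z gchoose k)) (at z)"
      using DERIV_mult[OF IH, of "\<lambda>x. x - of_nat k" 1] by (simp only: u_def[symmetric] v mult_1)
  qed
  moreover have "((z gchoose k) * (v - 1 / u) * u + (z gchoose k)) / of_nat (Suc k) =
      (z gchoose k) * u / of_nat (Suc k) * v"
    using u(1) by (simp add: field_simps del: of_nat_Suc)
  ultimately show ?case by (simp only: rec u(2) u_def v_def)
qed simp

lemma has_field_derivative_gchoose2:
  fixes z :: complex
  assumes "z - of_nat k + 1 \<notin> \<int>\<^sub>\<le>\<^sub>0" "z + 1 \<notin> \<int>\<^sub>\<le>\<^sub>0"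
  shows "((\<lambda>z. (z gchoose k) * (Digamma (z + 1) - Digamma (z - of_nat k + 1))) has_field_derivative
           (z gchoose k) * ((Digamma (z + 1) - Digamma (z - of_nat k + 1)) ^ 2 +
             deriv Digamma (z + 1) - deriv Digamma (z - of_nat k + 1))) (at z)"
  using assms
  by (auto intro!: derivative_eq_intros has_field_derivative_gchoose
      simp: deriv_Polygamma power2_eq_square algebra_simps)

section \<open>Differentiating the polynomial identity twice\<close>

theorem theorem2p11:
  fixes n :: nat and s :: complex
  assumes "n \<ge> 1"
    and "s \<notin> {- of_nat m | m :: nat. m \<ge> 1}"
  shows "(\<Sum>k = 1..n. ((s + of_nat n) gchoose k) * ((-1) ^ (k - 1) / of_nat k ^ 2) *
            ((Digamma (s + of_nat n + 1) - Digamma (s + of_nat n - of_nat k + 1)) ^ 2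
              + deriv Digamma (s + of_nat n + 1) - deriv Digamma (s + of_nat n - of_nat k + 1)))
       = 2 * (\<Sum>k = 0..n - 1. ((-1) ^ k / (of_nat k + 1)) * ((s + of_nat k) gchoose k) *
            ((harm n - harm k) / ((of_nat n - of_nat k) * of_nat (n choose k))) *
            (Digamma (s + of_nat k + 1) - Digamma (s + 1)))
       + s * (\<Sum>k = 0..n - 1. ((-1) ^ k / (of_nat k + 1)) * ((s + of_nat k) gchoose k) *
            ((harm n - harm k) / ((of_nat n - of_nat k) * of_nat (n choose k))) *
            ((Digamma (s + of_nat k + 1) - Digamma (s + 1)) ^ 2
              + deriv Digamma (s + of_nat k + 1) - deriv Digamma (s + 1)))"
proof -
  \<comment> \<open>The complement of the negative integers: no digamma argument below meets a pole
    for x in \<open>S\<close>. As \<open>S\<close> is open, an identity valid on it can be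
    differentiated at \<open>s\<close>.\<close>
  define S :: "complex set" where "S = {x. x + 1 \<notin> \<int>\<^sub>\<le>\<^sub>0}"
  define w :: "nat \<Rightarrow> complex"
    where "w k = (harm n - harm k) / ((of_nat n - of_nat k) * of_nat (n choose k))" for k
  have "s \<in> S"
  proof (rule ccontr)
    assume "s \<notin> S"
    then obtain m where "s + 1 = - of_nat m"
      by (auto simp: S_def elim!: nonpos_Ints_cases')
    then have "s = - of_nat m - 1" by (simp add: eq_diff_eq)
    then have "s = - of_nat (Suc m)" by simp
    then show False using assms(2) by force
  qed
  have "open S"
  proof -
    have "S = (\<lambda>x. x + 1) -` (- \<int>\<^sub>\<le>\<^sub>0)" by (auto simp: S_def)
    moreover have "open \<dots>" by (intro open_vimage continuous_intros) auto
    ultimately show ?thesis by simp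
  qed
  have shift: "x + of_nat m + 1 \<notin> \<int>\<^sub>\<le>\<^sub>0" if "x \<in> S" for x m
  proof
    assume "x + of_nat m + 1 \<in> \<int>\<^sub>\<le>\<^sub>0"
    then obtain j where "x + of_nat m + 1 = - of_nat j" by (elim nonpos_Ints_cases')
    then have "x + 1 = - of_nat (j + m)" by (simp add: algebra_simps)
    also have "\<dots> \<in> \<int>\<^sub>\<le>\<^sub>0" by (rule minus_of_nat_in_nonpos_Ints)
    finally show False using that by (simp add: S_def)
  qed
  have shift': "x + of_nat m - of_nat k + 1 \<notin> \<int>\<^sub>\<le>\<^sub>0" if "x \<in> S" "k \<le> m" for x m k
    using shift[OF that(1), of "m - k"] that(2) by (simp add: of_nat_diff add_diff_eq)

  \<comment> \<open>The left side uses \<open>b n k\<close>. The right side uses the diagonal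
    \<open>b k k\<close>, where the second digamma argument collapses to x+1. \<open>b1\<close> and
    \<open>b2\<close> are the first two derivatives.\<close>
  define b where "b m k x = (x + of_nat m gchoose k)" for m k and x :: complex
  define b1 where "b1 m k x = b m k x * (Digamma (x + of_nat m + 1) - Digamma (x + of_nat m - of_nat k + 1))"
    for m k and x :: complex
  define b2 where "b2 m k x = b m k x * ((Digamma (x + of_nat m + 1) - Digamma (x + of_nat m - of_nat k + 1)) ^ 2
      + deriv Digamma (x + of_nat m + 1) - deriv Digamma (x + of_nat m - of_nat k + 1))"
    for m k and x :: complex
  have b: "(b m k has_field_derivative b1 m k x) (at x)" if "x \<in> S" "k \<le> m" for x m k
    using has_field_derivative_gchoose[OF shift'[OF that]]
    unfolding b_def b1_def by (rule DERIV_shift[THEN iffD1])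
  have b1: "(b1 m k has_field_derivative b2 m k x) (at x)" if "x \<in> S" "k \<le> m" for x m k
    using has_field_derivative_gchoose2[OF shift'[OF that] shift[OF that(1)]]
    unfolding b_def b1_def b2_def by (rule DERIV_shift[THEN iffD1])

  define T :: complex where "T = (\<Sum>k = 1..n. of_nat (n choose k) * ((-1) ^ (k - 1) / of_nat k ^ 2))"
  \<comment> \<open>Both sums are linear in the family \<open>f\<close>, so differentiating them
    amounts to passing from \<open>b\<close> to \<open>b1\<close> to \<open>b2\<close>.\<close>
  define L R where "L = (\<lambda>f :: nat \<Rightarrow> nat \<Rightarrow> complex \<Rightarrow> complex. \<lambda>x. \<Sum>k = 1..n. f n k x * ((-1) ^ (k - 1) / of_nat k ^ 2))"
    and "R = (\<lambda>f :: nat \<Rightarrow> nat \<Rightarrow> complex \<Rightarrow> complex. \<lambda>x. \<Sum>k = 0..n - 1. ((-1) ^ k / (of_nat k + 1)) * f k k x * w k)"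
  have L: "(L b has_field_derivative L b1 x) (at x)" "(L b1 has_field_derivative L b2 x) (at x)" if "x \<in> S" for x
    unfolding L_def using that
    by (auto intro!: DERIV_sum DERIV_cmult_right b b1 simp del: times_divide_eq_right)
  have R: "(R b has_field_derivative R b1 x) (at x)" "(R b1 has_field_derivative R b2 x) (at x)" if "x \<in> S" for x
    unfolding R_def using that
    by (auto intro!: DERIV_sum DERIV_cmult_right DERIV_cmult b b1
        simp del: times_divide_eq_right times_divide_eq_left)
  have eq0: "L b x = T + x * R b x" for x
    using sum_gchoose_over_index_sq[where n = n] by (simp add: L_def R_def b_def T_def w_def)
  have eq1: "L b1 x = R b x + x * R b1 x" if "x \<in> S" for x
  proof (rule DERIV_unique)
    show "(L b has_field_derivative L b1 x) (at x)" using L that by blast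
    show "(L b has_field_derivative R b x + x * R b1 x) (at x)"
      unfolding eq0 [abs_def] by (auto intro!: derivative_eq_intros R that)
  qed
  have "L b2 s = 2 * R b1 s + s * R b2 s"
  proof (rule DERIV_unique)
    show "(L b1 has_field_derivative L b2 s) (at s)" using L \<open>s \<in> S\<close> by blast
    \<comment> \<open>The factor 2 arises because \<open>R b1\<close> comes once from
      \<open>R b\<close> and once from the factor x. Since \<open>eq1\<close> holds only on
      \<open>S\<close>, the derivative is transferred to \<open>L b1\<close> within this open
      set.\<close>
    have "((\<lambda>x. R b x + x * R b1 x) has_field_derivative 2 * R b1 s + s * R b2 s) (at s)"
      by (auto intro!: derivative_eq_intros R \<open>s \<in> S\<close>)
    then show "(L b1 has_field_derivative 2 * R b1 s + s * R b2 s) (at s)"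
      by (rule has_field_derivative_transform_within_open[OF _ \<open>open S\<close> \<open>s \<in> S\<close>]) (simp add: eq1)
  qed
  then show ?thesis
    by (simp add: L_def R_def b_def b1_def b2_def w_def mult_ac)
qed

end
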